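(* Let $\mathrm H_n$ be the Heisenberg Lie group endowed with the standard metric, let $r=(r_1,\dots,r_n)\in(\mathbb Z^+)^n$ with $r_1\mid r_2\mid\cdots\mid r_n$, and let $$\Lambda_r=\{(v,z): v=(x,y)\text{ with }x\in r\mathbb Z^n,\ y\in2\mathbb Z^n,\ z\in\mathbb Z\}.$$ If $\Lambda_r\backslash\mathrm H_n$ is the corresponding Heisenberg manifold (with the induced metric), then the geodesic flow in $T(\Lambda_r\backslash\mathrm H_n)$ is completely integrable with smooth first integrals.
   Context: The Heisenberg group $\mathrm H_n$ is $\mathbb R^{2n}\times\mathbb R$ with product $(v,z)(v',z')=(v+v',\,z+z'-\tfrac12 v^{\tau}Jv')$, where $J$ is multiplication by $i$ on $\mathbb R^{2n}\simeq\mathbb C^n$. Writing $v=(x,y)$ with $x,y\in\mathbb R^n$ means $v\leftrightarrow x+iy\in\mathbb C^n$, so $J(x,y)=(-y,x)$. Here $x\in r\mathbb Z^n$ means $x_i\in r_i\mathbb Z$ for all $i$. $\Lambda_r$ is a discrete cocompact subgroup of $\mathrm H_n$. The standard metric is the left-invariant Riemannian metric on $\mathrm H_n$ which at the identity $(0,0)$ is the standard Euclidean inner product of $\mathbb R^{2n+1}$ (equivalently, the left-invariant fields $X_1,\dots,X_{2n},Z_1$ extending the coordinate vectors at the identity are orthonormal). It induces a Riemannian metric on $\Lambda_r\backslash\mathrm H_n$ for which the projection $\mathrm H_n\to\Lambda_r\backslash\mathrm H_n$ is a local isometry. For a Riemannian manifold $M$, $TM$ carries the symplectic form $\Omega=-d\Theta$,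 $\Theta(\xi)=\langle v,d\pi(\xi)\rangle$ for $\xi\in T_v(TM)$, with $\pi:TM\to M$ the projection. The Hamiltonian vector field $X_f$ is defined by $df=\Omega(X_f,\cdot)$, $\{f,g\}=\Omega(X_f,X_g)$, and the geodesic flow is the Hamiltonian flow of the energy $\mathrm E(v)=\frac12\langle v,v\rangle$. A first integral is a function $f$ on $TM$ with $\{f,\mathrm E\}=0$. The geodesic flow is completely integrable (with smooth first integrals) if there exist $\dim M$ smooth functions on $TM$ which are first integrals, pairwise Poisson commute, and whose gradients are linearly independent on an open dense subset of $TM$. *)

theory Defs
  imports "HOL-Analysis.Analysis"
begin

section \<open>Smooth functions and differential forms on a Euclidean space\<close>

primrec C_k :: "nat \<Rightarrow> ('b::euclidean_space \<Rightarrow> real) \<Rightarrow> bool" where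
  "C_k 0 f \<longleftrightarrow> continuous_on UNIV f"
| "C_k (Suc k) f \<longleftrightarrow>
     (\<forall>x. f differentiable (at x)) \<and> (\<forall>v. C_k k (\<lambda>x. frechet_derivative f (at x) v))"

definition smooth :: "('b::euclidean_space \<Rightarrow> real) \<Rightarrow> bool" where
  "smooth f \<longleftrightarrow> (\<forall>k. C_k k f)"

(* d\<alpha>(\<xi>,\<eta>) = \<xi>(\<alpha>(\<eta>)) - \<eta>(\<alpha>(\<xi>)) - \<alpha>([\<xi>,\<eta>]), evaluated on constant vector fields, which commute. *)
definition exterior_derivative ::
    "('b::euclidean_space \<Rightarrow> 'b \<Rightarrow> real) \<Rightarrow> 'b \<Rightarrow> 'b \<Rightarrow> 'b \<Rightarrow> real" where
  "exterior_derivative \<alpha> w \<xi> \<eta> =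
     frechet_derivative (\<lambda>w'. \<alpha> w' \<eta>) (at w) \<xi> - frechet_derivative (\<lambda>w'. \<alpha> w' \<xi>) (at w) \<eta>"

section \<open>The tangent bundle of a Riemannian metric on a Euclidean space\<close>

text \<open>
  A Riemannian metric on the manifold \<open>'a\<close> is a function \<open>g\<close>, where \<open>g p u v\<close> is the inner product
  of \<open>u\<close> and \<open>v\<close> in the tangent space at \<open>p\<close>.  The tangent bundle is \<open>'a \<times> 'a\<close>, with
  \<open>(p, v)\<close> the vector \<open>v\<close> at the point \<open>p\<close> and with \<open>\<pi> = fst\<close>; so \<open>d\<pi> = fst\<close> too.
\<close>

type_synonym 'a metric_tensor = "'a \<Rightarrow> 'a \<Rightarrow> 'a \<Rightarrow> real"

definition Theta :: "'a::euclidean_space metric_tensor \<Rightarrow> 'a \<times> 'a \<Rightarrow> 'a \<times> 'a \<Rightarrow> real" where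
  "Theta g w \<xi> = g (fst w) (snd w) (fst \<xi>)"

definition Omega ::
    "'a::euclidean_space metric_tensor \<Rightarrow> 'a \<times> 'a \<Rightarrow> 'a \<times> 'a \<Rightarrow> 'a \<times> 'a \<Rightarrow> real" where
  "Omega g w \<xi> \<eta> = - exterior_derivative (Theta g) w \<xi> \<eta>"

definition hamiltonian_field ::
    "'a::euclidean_space metric_tensor \<Rightarrow> ('a \<times> 'a \<Rightarrow> real) \<Rightarrow> 'a \<times> 'a \<Rightarrow> 'a \<times> 'a" where
  "hamiltonian_field g f w = (THE \<xi>. \<forall>\<eta>. frechet_derivative f (at w) \<eta> = Omega g w \<xi> \<eta>)"

definition poisson ::
    "'a::euclidean_space metric_tensor \<Rightarrow> ('a \<times> 'a \<Rightarrow> real) \<Rightarrow> ('a \<times> 'a \<Rightarrow> real) \<Rightarrow> 'a \<times> 'a \<Rightarrow> real" where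
  "poisson g f f' w = Omega g w (hamiltonian_field g f w) (hamiltonian_field g f' w)"

definition energy :: "'a::euclidean_space metric_tensor \<Rightarrow> 'a \<times> 'a \<Rightarrow> real" where
  "energy g w = g (fst w) (snd w) (snd w) / 2"

definition is_inner_product :: "('b::real_vector \<Rightarrow> 'b \<Rightarrow> real) \<Rightarrow> bool" where
  "is_inner_product h \<longleftrightarrow>
     (\<forall>x. linear (h x)) \<and> (\<forall>x y. h x y = h y x) \<and> (\<forall>x. x \<noteq> 0 \<longrightarrow> h x x > 0)"

definition gradient ::
    "('b::euclidean_space \<Rightarrow> 'b \<Rightarrow> real) \<Rightarrow> ('b \<Rightarrow> real) \<Rightarrow> 'b \<Rightarrow> 'b" where
  "gradient h f w = (THE \<zeta>. \<forall>\<xi>. h \<zeta> \<xi> = frechet_derivative f (at w) \<xi>)"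

definition independent_family :: "nat \<Rightarrow> (nat \<Rightarrow> 'b::real_vector) \<Rightarrow> bool" where
  "independent_family m u \<longleftrightarrow>
     (\<forall>c. (\<Sum>i<m. c i *\<^sub>R u i) = 0 \<longrightarrow> (\<forall>i<m. c i = 0))"

section \<open>Quotient manifolds and their tangent bundles\<close>

definition orbit :: "('b \<Rightarrow> 'b) set \<Rightarrow> 'b \<Rightarrow> 'b set" where
  "orbit \<Gamma> x = (\<lambda>\<gamma>. \<gamma> x) ` \<Gamma>"

definition tangent_map :: "('a::euclidean_space \<Rightarrow> 'a) \<Rightarrow> 'a \<times> 'a \<Rightarrow> 'a \<times> 'a" where
  "tangent_map \<gamma> w = (\<gamma> (fst w), frechet_derivative \<gamma> (at (fst w)) (snd w))"

text \<open>
  Let \<open>\<Gamma>\<close> be a group of isometries of \<open>('a, g)\<close> acting freely and properly discontinuously, and let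
  \<open>M\<close> be the Riemannian manifold \<open>\<Gamma>\<setminus>'a\<close>.  The differential of the projection
  \<open>'a \<rightarrow> M\<close> identifies \<open>TM\<close> with the orbit space of \<open>'a \<times> 'a\<close> under the tangent maps of
  \<open>\<Gamma>\<close>, and \<open>tangent_proj \<Gamma>\<close> is that differential.  It is a covering and a local diffeomorphism,
  and it pulls the symplectic form of \<open>TM\<close> back to \<open>Omega g\<close>.  Hence local notions on \<open>TM\<close> are
  those on \<open>'a \<times> 'a\<close>, read off at any lift of the given point of \<open>TM\<close>.
\<close>

definition tangent_proj :: "('a::euclidean_space \<Rightarrow> 'a) set \<Rightarrow> 'a \<times> 'a \<Rightarrow> ('a \<times> 'a) set" where
  "tangent_proj \<Gamma> w = orbit (tangent_map ` \<Gamma>) w"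

definition tangent_bundle :: "('a::euclidean_space \<Rightarrow> 'a) set \<Rightarrow> ('a \<times> 'a) set set" where
  "tangent_bundle \<Gamma> = range (tangent_proj \<Gamma>)"

definition tangent_topology :: "('a::euclidean_space \<Rightarrow> 'a) set \<Rightarrow> ('a \<times> 'a) set topology" where
  "tangent_topology \<Gamma> = topology (\<lambda>U. U \<subseteq> tangent_bundle \<Gamma> \<and> open (tangent_proj \<Gamma> -` U))"

lemma openin_tangent_topology:
  "openin (tangent_topology \<Gamma>) U \<longleftrightarrow> U \<subseteq> tangent_bundle \<Gamma> \<and> open (tangent_proj \<Gamma> -` U)"
proof -
  have "istopology (\<lambda>U. U \<subseteq> tangent_bundle \<Gamma> \<and> open (tangent_proj \<Gamma> -` U))"
    unfolding istopology_def by (auto simp: vimage_Int vimage_Union)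
  then show ?thesis
    unfolding tangent_topology_def by simp
qed

lemma topspace_tangent_topology: "topspace (tangent_topology \<Gamma>) = tangent_bundle \<Gamma>"
proof -
  have "tangent_proj \<Gamma> -` tangent_bundle \<Gamma> = UNIV"
    by (auto simp: tangent_bundle_def)
  then have "openin (tangent_topology \<Gamma>) (tangent_bundle \<Gamma>)"
    by (simp add: openin_tangent_topology)
  then show ?thesis
    by (meson openin_tangent_topology openin_subset openin_topspace subset_antisym)
qed

definition tangent_lift :: "('a::euclidean_space \<Rightarrow> 'a) set \<Rightarrow> ('a \<times> 'a) set \<Rightarrow> 'a \<times> 'a" where
  "tangent_lift \<Gamma> W = (SOME w. tangent_proj \<Gamma> w = W)"

definition smooth_on_tangent_bundle ::
    "('a::euclidean_space \<Rightarrow> 'a) set \<Rightarrow> (('a \<times> 'a) set \<Rightarrow> real) \<Rightarrow> bool" where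
  "smooth_on_tangent_bundle \<Gamma> F \<longleftrightarrow> smooth (F \<circ> tangent_proj \<Gamma>)"

definition poisson_quotient ::
    "('a::euclidean_space \<Rightarrow> 'a) set \<Rightarrow> 'a metric_tensor \<Rightarrow>
     (('a \<times> 'a) set \<Rightarrow> real) \<Rightarrow> (('a \<times> 'a) set \<Rightarrow> real) \<Rightarrow> ('a \<times> 'a) set \<Rightarrow> real" where
  "poisson_quotient \<Gamma> g F G W =
     poisson g (F \<circ> tangent_proj \<Gamma>) (G \<circ> tangent_proj \<Gamma>) (tangent_lift \<Gamma> W)"

definition energy_quotient ::
    "('a::euclidean_space \<Rightarrow> 'a) set \<Rightarrow> 'a metric_tensor \<Rightarrow> ('a \<times> 'a) set \<Rightarrow> real" where
  "energy_quotient \<Gamma> g W = energy g (tangent_lift \<Gamma> W)"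

definition first_integral ::
    "('a::euclidean_space \<Rightarrow> 'a) set \<Rightarrow> 'a metric_tensor \<Rightarrow> (('a \<times> 'a) set \<Rightarrow> real) \<Rightarrow> bool" where
  "first_integral \<Gamma> g F \<longleftrightarrow>
     (\<forall>W\<in>tangent_bundle \<Gamma>. poisson_quotient \<Gamma> g F (energy_quotient \<Gamma> g) W = 0)"

text \<open>
  Gradients refer to a Riemannian metric on \<open>TM\<close>.  Whether they are independent does not depend on
  that metric, so none is singled out: independence is demanded for every inner product \<open>h\<close> on
  the tangent space of \<open>TM\<close> at \<open>W\<close>.
\<close>

definition gradients_independent_at ::
    "('a::euclidean_space \<Rightarrow> 'a) set \<Rightarrow> nat \<Rightarrow> (nat \<Rightarrow> ('a \<times> 'a) set \<Rightarrow> real) \<Rightarrow>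
     ('a \<times> 'a) set \<Rightarrow> bool" where
  "gradients_independent_at \<Gamma> m F W \<longleftrightarrow>
     (\<forall>h. is_inner_product h \<longrightarrow>
        independent_family m (\<lambda>i. gradient h (F i \<circ> tangent_proj \<Gamma>) (tangent_lift \<Gamma> W)))"

definition geodesic_flow_completely_integrable ::
    "('a::euclidean_space \<Rightarrow> 'a) set \<Rightarrow> 'a metric_tensor \<Rightarrow> bool" where
  "geodesic_flow_completely_integrable \<Gamma> g \<longleftrightarrow>
     (\<exists>F :: nat \<Rightarrow> ('a \<times> 'a) set \<Rightarrow> real.
        (\<forall>i<DIM('a). smooth_on_tangent_bundle \<Gamma> (F i)) \<and>
        (\<forall>i<DIM('a). first_integral \<Gamma> g (F i)) \<and>
        (\<forall>i<DIM('a). \<forall>j<DIM('a). \<forall>W\<in>tangent_bundle \<Gamma>. poisson_quotient \<Gamma> g (F i) (F j) W = 0) \<and>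
        (\<exists>U. openin (tangent_topology \<Gamma>) U \<and>
             tangent_topology \<Gamma> closure_of U = tangent_bundle \<Gamma> \<and>
             (\<forall>W\<in>U. gradients_independent_at \<Gamma> DIM('a) F W)))"

section \<open>Heisenberg groups and Heisenberg manifolds\<close>

text \<open>An element is \<open>((x, y), z)\<close>, where \<open>(x, y)\<close> stands for \<open>x + iy\<close>.\<close>

type_synonym 'n heis = "((real ^ 'n) \<times> (real ^ 'n)) \<times> real"

definition J :: "(real ^ 'n) \<times> (real ^ 'n) \<Rightarrow> (real ^ 'n) \<times> (real ^ 'n)" where
  "J v = (- snd v, fst v)"

definition heis_mult :: "'n::finite heis \<Rightarrow> 'n heis \<Rightarrow> 'n heis" where
  "heis_mult p q = (fst p + fst q, snd p + snd q - (fst p \<bullet> J (fst q)) / 2)"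

definition heis_inv :: "'n::finite heis \<Rightarrow> 'n heis" where
  "heis_inv p = - p"

text \<open>The left-invariant metric that is the Euclidean inner product at the identity.\<close>

definition heis_metric :: "'n::finite heis metric_tensor" where
  "heis_metric p u v =
     (let D = frechet_derivative (heis_mult (heis_inv p)) (at p) in D u \<bullet> D v)"

definition heis_lattice :: "nat ^ 'n::finite \<Rightarrow> 'n heis set" where
  "heis_lattice r =
     {((x, y), z) | x y z.
        (\<forall>i. \<exists>k::int. x $ i = real (r $ i) * of_int k) \<and>
        (\<forall>i. \<exists>k::int. y $ i = 2 * of_int k) \<and> z \<in> \<int>}"

definition heis_deck_group :: "nat ^ 'n::finite \<Rightarrow> ('n heis \<Rightarrow> 'n heis) set" where
  "heis_deck_group r = heis_mult ` heis_lattice r"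

text \<open>
  The deck group satisfies the standing assumptions made above for \<open>\<Gamma>\<close>: the lattice is a subgroup,
  left translations are isometries, and the action is free and properly discontinuous with
  Hausdorff quotient.
\<close>

lemma heis_mult_assoc: "heis_mult (heis_mult p q) s = heis_mult p (heis_mult q s)"
  by (simp add: heis_mult_def J_def inner_prod_def algebra_simps add_divide_distrib diff_divide_distrib)

lemma heis_mult_zero [simp]: "heis_mult 0 p = p" "heis_mult p 0 = p"
  by (simp_all add: heis_mult_def J_def inner_prod_def prod_eq_iff)

lemma heis_mult_inv [simp]: "heis_mult (heis_inv p) p = 0" "heis_mult p (heis_inv p) = 0"
  by (simp_all add: heis_mult_def heis_inv_def J_def inner_prod_def prod_eq_iff inner_commute)

lemma zero_in_heis_lattice: "0 \<in> heis_lattice r"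
  by (force simp: heis_lattice_def zero_prod_def intro: exI[of _ "0::int"])

lemma heis_lattice_inv: "p \<in> heis_lattice r \<Longrightarrow> heis_inv p \<in> heis_lattice r"
proof -
  assume "p \<in> heis_lattice r"
  then obtain x y z where p: "p = ((x, y), z)"
    and x: "\<And>i. \<exists>k::int. x $ i = real (r $ i) * of_int k"
    and y: "\<And>i. \<exists>k::int. y $ i = 2 * of_int k" and z: "z \<in> \<int>"
    by (auto simp: heis_lattice_def)
  have "\<exists>k::int. (- x) $ i = real (r $ i) * of_int k" for i
    using x[of i] by (metis mult_minus_right of_int_minus vector_uminus_component)
  moreover have "\<exists>k::int. (- y) $ i = 2 * of_int k" for i
    using y[of i] by (metis mult_minus_right of_int_minus vector_uminus_component)
  ultimately show ?thesis
    using z by (auto simp: heis_lattice_def heis_inv_def p)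
qed

lemma heis_lattice_mult:
  assumes "p \<in> heis_lattice r" "q \<in> heis_lattice r"
  shows "heis_mult p q \<in> heis_lattice r"
proof -
  obtain x y z where p: "p = ((x, y), z)"
    and x: "\<And>i. \<exists>k::int. x $ i = real (r $ i) * of_int k"
    and y: "\<And>i. \<exists>k::int. y $ i = 2 * of_int k" and z: "z \<in> \<int>"
    using assms(1) by (auto simp: heis_lattice_def)
  obtain x' y' z' where q: "q = ((x', y'), z')"
    and x': "\<And>i. \<exists>k::int. x' $ i = real (r $ i) * of_int k"
    and y': "\<And>i. \<exists>k::int. y' $ i = 2 * of_int k" and z': "z' \<in> \<int>"
    using assms(2) by (auto simp: heis_lattice_def)
  have int: "(a \<bullet> b) / 2 \<in> \<int>"
    if a: "\<And>i. \<exists>k::int. a $ i = real (r $ i) * of_int k" and b: "\<And>i. \<exists>k::int. b $ i = 2 * of_int k"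
    for a b :: "real ^ 'a"
  proof -
    have "(a \<bullet> b) / 2 = (\<Sum>i\<in>UNIV. a $ i * (b $ i / 2))"
      by (simp add: inner_vec_def sum_divide_distrib)
    also have "\<dots> \<in> \<int>"
    proof (intro Ints_sum Ints_mult)
      show "a $ i \<in> \<int>" for i
        using a[of i] by auto
      show "b $ i / 2 \<in> \<int>" for i
        using b[of i] by auto
    qed
    finally show ?thesis .
  qed
  have "z + z' - ((x, y) \<bullet> J (x', y')) / 2 = z + z' + (x \<bullet> y') / 2 - (x' \<bullet> y) / 2"
    by (simp add: J_def inner_prod_def field_simps inner_commute)
  also have "\<dots> \<in> \<int>"
    using z z' int[OF x y'] int[OF x' y] by auto
  finally have 1: "z + z' - ((x, y) \<bullet> J (x', y')) / 2 \<in> \<int>" .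
  have 2: "\<exists>k::int. (x + x') $ i = real (r $ i) * of_int k" for i
    using x[of i] x'[of i] by (metis distrib_left of_int_add vector_add_component)
  have 3: "\<exists>k::int. (y + y') $ i = 2 * of_int k" for i
    using y[of i] y'[of i] by (metis distrib_left of_int_add vector_add_component)
  show ?thesis
    using 1 2 3 by (auto simp: heis_lattice_def heis_mult_def p q)
qed

lemma linear_J: "linear J"
  by (rule linearI) (simp_all add: J_def)

lemma has_derivative_heis_mult:
  "(heis_mult p has_derivative (\<lambda>u. (fst u, snd u - (fst p \<bullet> J (fst u)) / 2))) (at q)"
proof -
  have J: "bounded_linear (J :: (real ^ 'a) \<times> (real ^ 'a) \<Rightarrow> _)"
    using linear_J linear_conv_bounded_linear by blast
  show ?thesis
    unfolding heis_mult_def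
    by (auto intro!: derivative_eq_intros bounded_linear.has_derivative[OF J])
qed

lemma differentiable_heis_mult: "heis_mult p differentiable (at q)"
  using has_derivative_heis_mult by (rule differentiableI)

lemma heis_metric_left_invariant:
  "heis_metric (heis_mult a p) (frechet_derivative (heis_mult a) (at p) u)
     (frechet_derivative (heis_mult a) (at p) v) = heis_metric p u v"
proof -
  define b where "b = heis_inv (heis_mult a p)"
  have "heis_mult b (heis_mult a p) = 0"
    by (simp add: b_def)
  then have "heis_mult (heis_mult b a) p = 0"
    by (simp add: heis_mult_assoc)
  then have ba: "heis_mult b a = heis_inv p"
    by (metis heis_mult_assoc heis_mult_inv(2) heis_mult_zero)
  have "(heis_mult b \<circ> heis_mult a has_derivative
      frechet_derivative (heis_mult b) (at (heis_mult a p)) \<circ> frechet_derivative (heis_mult a) (at p)) (at p)"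
    by (intro diff_chain_at) (simp_all add: differentiable_heis_mult flip: frechet_derivative_works)
  moreover have "heis_mult b \<circ> heis_mult a = heis_mult (heis_inv p)"
    by (simp add: fun_eq_iff ba flip: heis_mult_assoc)
  ultimately have "frechet_derivative (heis_mult (heis_inv p)) (at p) =
      frechet_derivative (heis_mult b) (at (heis_mult a p)) \<circ> frechet_derivative (heis_mult a) (at p)"
    by (simp add: frechet_derivative_at[symmetric])
  then show ?thesis
    by (simp add: heis_metric_def Let_def b_def)
qed

lemma heis_metric_zero: "heis_metric 0 u v = u \<bullet> v"
proof -
  have "heis_mult (heis_inv 0) = (\<lambda>p :: 'a heis. p)"
    by (simp add: fun_eq_iff heis_inv_def)
  then show ?thesis
    by (simp add: heis_metric_def Let_def)
qed

lemma closed_heis_lattice: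
  assumes r: "\<forall>i. 0 < r $ i"
  shows "closed (heis_lattice r)" "closed (heis_lattice r - {0})"
proof -
  have mult: "(\<exists>k::int. t = c * of_int k) \<longleftrightarrow> t / c \<in> \<int>" if "c \<noteq> 0" for t c :: real
    using that by (auto simp: field_simps elim!: Ints_cases)
  have L: "heis_lattice r =
      (\<Inter>i. {p. fst (fst p) $ i / real (r $ i) \<in> \<int>}) \<inter> (\<Inter>i. {p. snd (fst p) $ i / 2 \<in> \<int>}) \<inter> {p. snd p \<in> \<int>}"
    using r by (auto simp: heis_lattice_def mult less_imp_neq[symmetric])
  have cl: "closed {p :: 'a heis. f p \<in> \<int>}" if "continuous_on UNIV f" for f :: "'a heis \<Rightarrow> real"
    using continuous_closed_preimage[OF that closed_UNIV closed_Ints] by (simp add: vimage_def)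
  show *: "closed (heis_lattice r)"
    unfolding L using r
    by (intro closed_Int closed_INT ballI cl continuous_intros) auto
  have "p = 0" if p: "p \<in> heis_lattice r" "norm p < 1" for p
  proof -
    obtain x y z where p': "p = ((x, y), z)"
      and x: "\<And>i. \<exists>k::int. x $ i = real (r $ i) * of_int k"
      and y: "\<And>i. \<exists>k::int. y $ i = 2 * of_int k" and z: "z \<in> \<int>"
      using p(1) by (auto simp: heis_lattice_def)
    have n: "norm (x, y) < 1" "\<bar>z\<bar> < 1"
      using p(2) norm_fst_le[of "(x, y)" z] norm_snd_le[of z "(x, y)"] by (auto simp: p')
    then have "norm x < 1" "norm y < 1"
      using norm_fst_le[of x y] norm_snd_le[of y x] by linarith+
    then have "\<bar>x $ i\<bar> < 1" "\<bar>y $ i\<bar> < 1" for i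
      using component_le_norm_cart[of x i] component_le_norm_cart[of y i] by linarith+
    moreover have "x $ i \<in> \<int>" "y $ i \<in> \<int>" for i
      using x[of i] y[of i] by auto
    ultimately have "x $ i = 0" "y $ i = 0" for i
      by (meson Ints_nonzero_abs_less1)+
    then show ?thesis
      using z n(2) by (auto simp: p' vec_eq_iff zero_prod_def intro: Ints_nonzero_abs_less1)
  qed
  then have "heis_lattice r - {0} = heis_lattice r \<inter> - ball 0 1"
    by auto
  then show "closed (heis_lattice r - {0})"
    using * by (simp add: closed_Int closed_Compl)
qed

lemma heis_separate:
  assumes K: "closed K" and "heis_mult q (heis_inv p) \<notin> K"
  shows "\<exists>U V. open U \<and> open V \<and> p \<in> U \<and> q \<in> V \<and> (\<forall>k\<in>K. heis_mult k ` U \<inter> V = {})"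
proof -
  have J: "continuous_on S (\<lambda>x. J (f x))" if "continuous_on S f"
    for S :: "('a heis \<times> 'a heis) set" and f
    unfolding J_def by (intro continuous_intros that)
  define d :: "'a heis \<times> 'a heis \<Rightarrow> 'a heis" where "d = (\<lambda>w. heis_mult (snd w) (heis_inv (fst w)))"
  have "continuous_on UNIV d"
    unfolding d_def heis_mult_def heis_inv_def by (intro continuous_intros J) auto
  then have "open (d -` (- K))"
    using K by (intro open_vimage) auto
  moreover have "(p, q) \<in> d -` (- K)"
    using assms by (simp add: d_def)
  ultimately obtain U V where UV: "open U" "open V" "p \<in> U" "q \<in> V" "U \<times> V \<subseteq> d -` (- K)"
    by (rule open_prod_elim) (simp only: mem_Times_iff fst_conv snd_conv)
  have "heis_mult k u \<notin> V" if "k \<in> K" "u \<in> U" for k u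
  proof
    assume "heis_mult k u \<in> V"
    with that UV have "d (u, heis_mult k u) \<notin> K"
      by blast
    then show False
      using that by (simp add: d_def heis_mult_assoc)
  qed
  with UV show ?thesis
    by blast
qed

lemma heis_lattice_properly_discontinuous:
  assumes "\<forall>i. 0 < r $ i"
  shows "\<exists>U. open U \<and> p \<in> U \<and> (\<forall>k \<in> heis_lattice r - {0}. heis_mult k ` U \<inter> U = {})"
proof -
  obtain U V where "open U" "open V" "p \<in> U" "p \<in> V"
    "\<forall>k \<in> heis_lattice r - {0}. heis_mult k ` U \<inter> V = {}"
    using heis_separate[OF closed_heis_lattice(2)[OF assms], of p p] by auto
  then show ?thesis
    by (intro exI[of _ "U \<inter> V"]) blast
qed

lemma heis_lattice_quotient_hausdorff:
  assumes "\<forall>i. 0 < r $ i" and "\<forall>k \<in> heis_lattice r. heis_mult k p \<noteq> q"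
  shows "\<exists>U V. open U \<and> open V \<and> p \<in> U \<and> q \<in> V \<and> (\<forall>k\<in>heis_lattice r. heis_mult k ` U \<inter> V = {})"
proof (rule heis_separate[OF closed_heis_lattice(1)[OF assms(1)]])
  show "heis_mult q (heis_inv p) \<notin> heis_lattice r"
    using assms(2) by (metis heis_mult_assoc heis_mult_inv(1) heis_mult_zero(2))
qed

end

theory Submission
  imports Defs
begin

text \<open>
  Writing a tangent vector in the left-invariant frame as \<open>(a, b, \<zeta>)\<close> with \<open>a, b \<in> \<real>\<^sup>n\<close>, the
  functions \<open>\<zeta>\<close> and \<open>a\<^sub>i\<^sup>2 + b\<^sub>i\<^sup>2\<close> are left-invariant, Poisson commute, and \<open>2E\<close> is
  \<open>\<zeta>\<^sup>2\<close> plus the sum of the latter.  The momenta \<open>b\<^sub>i - \<zeta> x\<^sub>i\<close> of the Killing fields given by left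
  translations in the directions \<open>y\<^sub>i\<close> commute with each other and with all left-invariant
  functions.  They are not invariant under the lattice, but \<open>b\<^sub>i/\<zeta> - x\<^sub>i\<close> changes only by
  integers, so \<open>exp (-1/\<zeta>\<^sup>2) sin (2\<pi> (b\<^sub>i/\<zeta> - x\<^sub>i))\<close> is invariant; the exponential factor makes it
  smooth where \<open>\<zeta>\<close> vanishes.
\<close>

section \<open>Flat oscillating functions\<close>

text \<open>Reduces smoothness to exhibiting a class of functions stable under directional
  derivatives, so no iterated derivative is computed.\<close>

lemma C_k_of_derivative_closed:
  fixes S :: "('b::euclidean_space \<Rightarrow> real) set"
  assumes "\<And>f. f \<in> S \<Longrightarrow> \<exists>f'. (\<forall>x. (f has_derivative f' x) (at x)) \<and> (\<forall>v. (\<lambda>x. f' x v) \<in> S)"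
    and "f \<in> S"
  shows "C_k k f"
  using assms(2)
proof (induction k arbitrary: f)
  case 0
  then obtain f' where "\<And>x. (f has_derivative f' x) (at x)"
    using assms(1) by blast
  then show ?case
    by (auto intro!: continuous_at_imp_continuous_on has_derivative_continuous)
next
  case (Suc k)
  then obtain f' where f': "\<And>x. (f has_derivative f' x) (at x)" "\<And>v. (\<lambda>x. f' x v) \<in> S"
    using assms(1) by blast
  then have "frechet_derivative f (at x) = f' x" for x
    by (simp add: frechet_derivative_at[symmetric])
  with f' Suc.IH show ?case
    by (auto simp: differentiable_def)
qed

lemma real_polynomial_function_has_derivative:
  assumes "real_polynomial_function p"
  shows "\<exists>p'. (\<forall>x. (p has_derivative p' x) (at x)) \<and> (\<forall>v. real_polynomial_function (\<lambda>x. p' x v))"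
  using assms
proof induction
  case (linear f)
  then show ?case
    by (intro exI[of _ "\<lambda>_. f"]) (auto intro: bounded_linear_imp_has_derivative real_polynomial_function.intros)
next
  case (const c)
  show ?case
    by (intro exI[of _ "\<lambda>_ _. 0"]) (auto intro: real_polynomial_function.intros)
next
  case (add f g)
  then obtain f' g' where "\<forall>x. (f has_derivative f' x) (at x)" "\<forall>v. real_polynomial_function (\<lambda>x. f' x v)"
    "\<forall>x. (g has_derivative g' x) (at x)" "\<forall>v. real_polynomial_function (\<lambda>x. g' x v)"
    by blast
  then show ?case
    by (intro exI[of _ "\<lambda>x v. f' x v + g' x v"]) (auto intro: has_derivative_add real_polynomial_function.intros)
next
  case (mult f g)
  then obtain f' g' where "\<forall>x. (f has_derivative f' x) (at x)" "\<forall>v. real_polynomial_function (\<lambda>x. f' x v)"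
    "\<forall>x. (g has_derivative g' x) (at x)" "\<forall>v. real_polynomial_function (\<lambda>x. g' x v)"
    by blast
  with mult.hyps show ?case
    by (intro exI[of _ "\<lambda>x v. f x * g' x v + f' x v * g x"])
       (auto intro!: has_derivative_mult real_polynomial_function.intros(3,4))
qed

text \<open>With \<open>t = 1 / s\<^sup>2\<close> this is a power of \<open>t\<close> against
  \<open>exp t\<close>. Bounding \<open>1 / \<bar>s\<bar>\<close> by \<open>t\<close> for
  \<open>\<bar>s\<bar> < 1\<close> avoids half-integer powers of \<open>t\<close>.\<close>

lemma exp_neg_inverse_square_over_power_tendsto_0:
  "((\<lambda>s::real. exp (- 1 / s\<^sup>2) / s ^ m) \<longlongrightarrow> 0) (at 0)"
proof (rule Lim_null_comparison)
  have inv: "filterlim (\<lambda>s::real. 1 / s\<^sup>2) at_top (at 0)"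
    by (auto simp: divide_inverse eventually_at intro!: filterlim_inverse_at_top tendsto_eq_intros exI[of _ 1])
  show "((\<lambda>s::real. (1 / s\<^sup>2) ^ m / exp (1 / s\<^sup>2)) \<longlongrightarrow> 0) (at 0)"
    using filterlim_compose[OF tendsto_power_div_exp_0 inv] .
  have "norm (exp (- 1 / s\<^sup>2) / s ^ m) \<le> (1 / s\<^sup>2) ^ m / exp (1 / s\<^sup>2)" if "s \<noteq> 0" "\<bar>s\<bar> < 1" for s :: real
  proof -
    have "\<bar>s\<bar> * \<bar>s\<bar> \<le> \<bar>s\<bar> * 1"
      using that by (intro mult_left_mono) auto
    then have "s\<^sup>2 \<le> \<bar>s\<bar>"
      by (simp add: power2_eq_square)
    then have "1 / \<bar>s\<bar> \<le> 1 / s\<^sup>2"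
      using that by (intro divide_left_mono) auto
    then have "(1 / \<bar>s\<bar>) ^ m \<le> (1 / s\<^sup>2) ^ m"
      by (intro power_mono) auto
    then have "(1 / \<bar>s\<bar>) ^ m * exp (- 1 / s\<^sup>2) \<le> (1 / s\<^sup>2) ^ m * exp (- 1 / s\<^sup>2)"
      by (intro mult_right_mono) auto
    then show ?thesis
      by (simp add: exp_minus divide_inverse power_abs power_inverse abs_mult mult.commute)
  qed
  then show "\<forall>\<^sub>F s in at 0. norm (exp (- 1 / s\<^sup>2) / s ^ m) \<le> (1 / s\<^sup>2) ^ m / exp (1 / s\<^sup>2)"
    by (auto simp: eventually_at intro!: exI[of _ 1])
qed

text \<open>The difference quotient of \<open>f\<close> tends to 0 and stays so under a bounded
  factor. Thus \<open>g\<close> may oscillate wildly near \<open>x\<close>, as the sine of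
  \<open>b / z\<close> can where \<open>z\<close> vanishes.\<close>

lemma has_derivative_zero_mult_bounded:
  fixes f g :: "'b::real_normed_vector \<Rightarrow> real"
  assumes f: "(f has_derivative (\<lambda>_. 0)) (at x)" "f x = 0"
    and g: "\<forall>\<^sub>F y in at x. \<bar>g y\<bar> \<le> C"
  shows "((\<lambda>y. f y * g y) has_derivative (\<lambda>_. 0)) (at x)"
proof -
  have "((\<lambda>y. f y / norm (y - x)) \<longlongrightarrow> 0) (at x)"
    using f by (simp add: has_derivative_at_within tendsto_norm_zero_iff divide_inverse mult.commute)
  then have lim: "((\<lambda>y. norm ((f y / norm (y - x)) * C)) \<longlongrightarrow> 0) (at x)"
    by (intro tendsto_norm_zero tendsto_mult_left_zero)
  have "\<forall>\<^sub>F y in at x. norm ((f y * g y) / norm (y - x)) \<le> norm ((f y / norm (y - x)) * C)"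
    using g
  proof eventually_elim
    case (elim y)
    then have "\<bar>f y / norm (y - x)\<bar> * \<bar>g y\<bar> \<le> \<bar>f y / norm (y - x)\<bar> * \<bar>C\<bar>"
      by (intro mult_left_mono) auto
    then show ?case
      by (simp add: abs_mult)
  qed
  from Lim_null_comparison[OF this lim]
  have "((\<lambda>y. (f y * g y) / norm (y - x)) \<longlongrightarrow> 0) (at x)" .
  then show ?thesis
    using f by (simp add: has_derivative_at_within divide_inverse mult.commute)
qed

text \<open>The exponent \<open>m\<close> and the phase \<open>c\<close> are parameters so that
  differentiation stays within the family: the chain rule raises \<open>m\<close>, and a cosine is a
  sine with phase \<open>c + pi / 2\<close>.\<close>

definition flat_osc :: "('b \<Rightarrow> real) \<Rightarrow> ('b \<Rightarrow> real) \<Rightarrow> nat \<Rightarrow> real \<Rightarrow> 'b \<Rightarrow> real" where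
  "flat_osc z b m c x =
     (if z x = 0 then 0 else exp (- 1 / (z x)\<^sup>2) / z x ^ m * sin (2 * pi * b x / z x + c))"

text \<open>The chain rule for increments \<open>dz\<close> and \<open>db\<close> of
  \<open>z\<close> and \<open>b\<close>. The three terms with \<open>dz\<close> come from the
  exponential, the power and the phase, in this order.\<close>

definition flat_osc_deriv ::
    "('b \<Rightarrow> real) \<Rightarrow> ('b \<Rightarrow> real) \<Rightarrow> nat \<Rightarrow> real \<Rightarrow> real \<Rightarrow> real \<Rightarrow> 'b \<Rightarrow> real" where
  "flat_osc_deriv z b m c dz db x =
     dz * (2 * flat_osc z b (m + 3) c x - real m * flat_osc z b (m + 1) c x
        - 2 * pi * b x * flat_osc z b (m + 2) (c + pi / 2) x)
     + db * (2 * pi * flat_osc z b (m + 1) (c + pi / 2) x)"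

lemma has_derivative_flat_osc:
  fixes z b :: "'b::real_normed_vector \<Rightarrow> real"
  assumes z: "(z has_derivative z') (at x)" and b: "(b has_derivative b') (at x)"
  shows "(flat_osc z b m c has_derivative (\<lambda>v. flat_osc_deriv z b m c (z' v) (b' v) x)) (at x)"
proof (cases "z x = 0")
  case True
  define h where "h s = (if s = 0 then 0 else exp (- 1 / s\<^sup>2) / s ^ m)" for s :: real
  \<comment> \<open>The difference quotient of \<open>h\<close> at 0 is the same expression with
    exponent \<open>m + 1\<close>.\<close>
  have "((\<lambda>s. h s / s) \<longlongrightarrow> 0) (at 0)"
    using exp_neg_inverse_square_over_power_tendsto_0[of "Suc m"]
    by (rule Lim_transform_eventually) (auto simp: eventually_at h_def field_simps intro!: exI[of _ 1])
  then have "(h has_field_derivative 0) (at 0)"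
    by (simp add: has_field_derivative_iff h_def)
  then have "((\<lambda>y. h (z y)) has_derivative (\<lambda>_. 0)) (at x)"
    using has_derivative_compose[OF z, of h "\<lambda>_. 0"] True
    by (simp add: has_field_derivative_def lambda_zero)
  then have "((\<lambda>y. h (z y) * sin (2 * pi * b y / z y + c)) has_derivative (\<lambda>_. 0)) (at x)"
    by (rule has_derivative_zero_mult_bounded[where C = 1]) (simp_all add: h_def True)
  moreover have "flat_osc z b m c = (\<lambda>y. h (z y) * sin (2 * pi * b y / z y + c))"
    by (auto simp: flat_osc_def h_def)
  ultimately show ?thesis
    using True by (simp add: flat_osc_deriv_def flat_osc_def)
next
  case False
  have shift: "sin (t + (c + pi / 2)) = cos (t + c)" for t
    by (simp add: sin_add cos_add)
  define Z B where "Z = z x" and "B = b x"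
  define e where "e = exp (- 1 / Z\<^sup>2)"
  have Z: "Z \<noteq> 0"
    using False by (simp add: Z_def)
  have "((\<lambda>s. - 1 / s\<^sup>2) has_real_derivative 2 / Z ^ 3) (at Z)"
    using Z by (auto intro!: derivative_eq_intros simp: field_simps power2_eq_square power3_eq_cube)
  then have de: "((\<lambda>s. exp (- 1 / s\<^sup>2)) has_real_derivative e * (2 / Z ^ 3)) (at Z)"
    unfolding e_def by (rule DERIV_chain2[OF DERIV_exp])
  \<comment> \<open>The split on \<open>m\<close> avoids the truncated exponent \<open>m - 1\<close>
    of the power rule at \<open>m = 0\<close>.\<close>
  have dp: "((\<lambda>s. 1 / s ^ m) has_real_derivative - (real m / Z ^ (m + 1))) (at Z)"
  proof (cases m)
    case (Suc k)
    have "((\<lambda>s. inverse (s ^ Suc k)) has_real_derivative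
        - (real (Suc k) * Z ^ k * inverse ((Z ^ Suc k) ^ Suc (Suc 0)))) (at Z)"
      using Z DERIV_inverse_fun[OF DERIV_pow[of "Suc k" Z UNIV]] by (simp del: power_Suc)
    moreover have "real (Suc k) * Z ^ k * inverse ((Z ^ Suc k) ^ Suc (Suc 0)) = real (Suc k) / Z ^ (Suc k + 1)"
      using Z by (simp add: divide_simps)
    ultimately show ?thesis
      by (simp only: Suc divide_inverse mult_1_left)
  qed simp
  have "((\<lambda>s. exp (- 1 / s\<^sup>2) * (1 / s ^ m)) has_real_derivative
      e * (2 / Z ^ (m + 3)) - e * (real m / Z ^ (m + 1))) (at Z)"
    using DERIV_mult[OF de dp] by (rule DERIV_cong) (simp add: e_def power_add mult.commute)
  from has_derivative_compose[OF z this[unfolded has_field_derivative_def Z_def]]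
  have 1: "((\<lambda>y. exp (- 1 / (z y)\<^sup>2) / z y ^ m) has_derivative
      (\<lambda>v. (e * (2 / Z ^ (m + 3)) - e * (real m / Z ^ (m + 1))) * z' v)) (at x)"
    by (simp add: Z_def)
  have "((\<lambda>y. 2 * pi * b y / z y + c) has_derivative
      (\<lambda>v. 2 * pi * (b' v / Z - B * z' v / Z\<^sup>2))) (at x)"
    using Z by (auto intro!: derivative_eq_intros z b simp: Z_def B_def field_simps power2_eq_square)
  from has_derivative_compose[OF this DERIV_sin[unfolded has_field_derivative_def]]
  have 2: "((\<lambda>y. sin (2 * pi * b y / z y + c)) has_derivative
      (\<lambda>v. cos (2 * pi * B / Z + c) * (2 * pi * (b' v / Z - B * z' v / Z\<^sup>2)))) (at x)"
    by (simp add: Z_def B_def)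
  have "((\<lambda>y. exp (- 1 / (z y)\<^sup>2) / z y ^ m * sin (2 * pi * b y / z y + c)) has_derivative
      (\<lambda>v. flat_osc_deriv z b m c (z' v) (b' v) x)) (at x)"
  proof (rule has_derivative_eq_rhs[OF has_derivative_mult[OF 1 2]], rule ext)
    fix v
    have *: "flat_osc z b k c x = e / Z ^ k * sin (2 * pi * B / Z + c)"
      "flat_osc z b k (c + pi / 2) x = e / Z ^ k * cos (2 * pi * B / Z + c)" for k
      using Z by (simp_all add: flat_osc_def shift Z_def B_def e_def)
    show "exp (- 1 / (z x)\<^sup>2) / z x ^ m *
        (cos (2 * pi * B / Z + c) * (2 * pi * (b' v / Z - B * z' v / Z\<^sup>2))) +
        (e * (2 / Z ^ (m + 3)) - e * (real m / Z ^ (m + 1))) * z' v * sin (2 * pi * b x / z x + c) =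
      flat_osc_deriv z b m c (z' v) (b' v) x"
      unfolding flat_osc_deriv_def * Z_def[symmetric] B_def[symmetric] e_def[symmetric]
      using Z by (simp add: power_add algebra_simps power2_eq_square)
  qed
  moreover have "\<forall>\<^sub>F y in at x. z y \<noteq> 0"
    using has_derivative_continuous[OF z] False
    by (simp add: isCont_def tendsto_imp_eventually_ne)
  then have "\<forall>\<^sub>F y in at x. exp (- 1 / (z y)\<^sup>2) / z y ^ m * sin (2 * pi * b y / z y + c) = flat_osc z b m c y"
    by eventually_elim (simp add: flat_osc_def)
  ultimately show ?thesis
    using False by (elim has_derivative_transform_eventually) (simp_all add: flat_osc_def)
qed

text \<open>Polynomials are included because they occur as coefficients when
  \<open>flat_osc z b m c\<close> is differentiated. For polynomial \<open>z\<close> and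
  \<open>b\<close> the class is therefore stable under directional derivatives.\<close>

inductive_set flat_osc_algebra :: "('b::euclidean_space \<Rightarrow> real) \<Rightarrow> ('b \<Rightarrow> real) \<Rightarrow> ('b \<Rightarrow> real) set"
  for z b where
  poly: "real_polynomial_function p \<Longrightarrow> p \<in> flat_osc_algebra z b"
| osc: "flat_osc z b m c \<in> flat_osc_algebra z b"
| add: "\<lbrakk>f \<in> flat_osc_algebra z b; g \<in> flat_osc_algebra z b\<rbrakk> \<Longrightarrow> (\<lambda>x. f x + g x) \<in> flat_osc_algebra z b"
| mult: "\<lbrakk>f \<in> flat_osc_algebra z b; g \<in> flat_osc_algebra z b\<rbrakk> \<Longrightarrow> (\<lambda>x. f x * g x) \<in> flat_osc_algebra z b"

lemma flat_osc_algebra_const: "(\<lambda>_. k) \<in> flat_osc_algebra z b"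
  by (intro flat_osc_algebra.poly real_polynomial_function.intros)

lemma flat_osc_algebra_diff:
  assumes "f \<in> flat_osc_algebra z b" "g \<in> flat_osc_algebra z b"
  shows "(\<lambda>x. f x - g x) \<in> flat_osc_algebra z b"
proof -
  have "(\<lambda>x. f x + (- 1) * g x) \<in> flat_osc_algebra z b"
    by (intro flat_osc_algebra.add flat_osc_algebra.mult flat_osc_algebra_const assms)
  then show ?thesis
    by simp
qed

lemma flat_osc_algebra_has_derivative:
  assumes z: "real_polynomial_function z" and b: "real_polynomial_function b"
    and "f \<in> flat_osc_algebra z b"
  shows "\<exists>f'. (\<forall>x. (f has_derivative f' x) (at x)) \<and> (\<forall>v. (\<lambda>x. f' x v) \<in> flat_osc_algebra z b)"
  using assms(3)
proof induction
  case (poly p)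
  then obtain p' where "\<forall>x. (p has_derivative p' x) (at x)" "\<forall>v. real_polynomial_function (\<lambda>x. p' x v)"
    using real_polynomial_function_has_derivative by blast
  then show ?case
    by (auto intro: flat_osc_algebra.poly)
next
  case (osc m c)
  obtain z' b' where z': "\<And>x. (z has_derivative z' x) (at x)" "\<And>v. real_polynomial_function (\<lambda>x. z' x v)"
    and b': "\<And>x. (b has_derivative b' x) (at x)" "\<And>v. real_polynomial_function (\<lambda>x. b' x v)"
    using real_polynomial_function_has_derivative[OF z] real_polynomial_function_has_derivative[OF b] by blast
  have "(\<lambda>x. flat_osc_deriv z b m c (z' x v) (b' x v) x) \<in> flat_osc_algebra z b" for v
    unfolding flat_osc_deriv_def
    by (intro flat_osc_algebra.add flat_osc_algebra.mult flat_osc_algebra_const flat_osc_algebra_diff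
        flat_osc_algebra.osc flat_osc_algebra.poly[OF z'(2)] flat_osc_algebra.poly[OF b'(2)] flat_osc_algebra.poly[OF b])
  then show ?case
    using has_derivative_flat_osc[OF z'(1) b'(1)]
    by (intro exI[of _ "\<lambda>x v. flat_osc_deriv z b m c (z' x v) (b' x v) x"]) simp
next
  case (add f g)
  then obtain f' g' where "\<forall>x. (f has_derivative f' x) (at x)" "\<forall>v. (\<lambda>x. f' x v) \<in> flat_osc_algebra z b"
    "\<forall>x. (g has_derivative g' x) (at x)" "\<forall>v. (\<lambda>x. g' x v) \<in> flat_osc_algebra z b"
    by blast
  then show ?case
    by (intro exI[of _ "\<lambda>x v. f' x v + g' x v"]) (auto intro: has_derivative_add flat_osc_algebra.add)
next
  case (mult f g)
  then obtain f' g' where "\<forall>x. (f has_derivative f' x) (at x)" "\<forall>v. (\<lambda>x. f' x v) \<in> flat_osc_algebra z b"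
    "\<forall>x. (g has_derivative g' x) (at x)" "\<forall>v. (\<lambda>x. g' x v) \<in> flat_osc_algebra z b"
    by blast
  with mult.hyps show ?case
    by (intro exI[of _ "\<lambda>x v. f x * g' x v + f' x v * g x"])
       (auto intro!: has_derivative_mult flat_osc_algebra.add flat_osc_algebra.mult)
qed

lemma smooth_flat_osc_algebra:
  assumes "real_polynomial_function z" "real_polynomial_function b" "f \<in> flat_osc_algebra z b"
  shows "smooth f"
  using C_k_of_derivative_closed[OF flat_osc_algebra_has_derivative[OF assms(1,2)] assms(3)]
  by (simp add: smooth_def)

section \<open>Gradients and dense sets\<close>

text \<open>Riesz representation: \<open>h x\<close> is the Euclidean pairing with
  \<open>A x\<close>, and definiteness makes \<open>A\<close> injective, hence surjective in finite
  dimension. So \<open>gradient\<close> is well defined for every \<open>h\<close>.\<close>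

lemma inner_product_represents:
  fixes h :: "'b::euclidean_space \<Rightarrow> 'b \<Rightarrow> real"
  assumes h: "is_inner_product h" and l: "linear l"
  shows "\<exists>!u. \<forall>v. h u v = l v"
proof -
  have lin: "linear (h x)" and sym: "h x y = h y x" and pos: "x \<noteq> 0 \<Longrightarrow> h x x > 0" for x y
    using h by (auto simp: is_inner_product_def)
  define A where "A x = (\<Sum>e\<in>Basis. h e x *\<^sub>R e)" for x
  have hA: "h x v = A x \<bullet> v" for x v
  proof -
    have "h x v = h x (\<Sum>e\<in>Basis. (v \<bullet> e) *\<^sub>R e)"
      by (simp add: euclidean_representation)
    also have "\<dots> = (\<Sum>e\<in>Basis. (v \<bullet> e) * h e x)"
      using sym[of x] by (simp add: linear_sum[OF lin] linear_cmul[OF lin])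
    also have "\<dots> = A x \<bullet> v"
      by (simp add: A_def inner_sum_right inner_commute[of _ v] mult.commute)
    finally show ?thesis .
  qed
  have linA: "linear A"
    unfolding A_def
    by (rule linearI)
      (simp_all add: linear_add[OF lin] linear_cmul[OF lin] scaleR_add_left sum.distrib scaleR_sum_right)
  have "inj A"
    unfolding linear_injective_0[OF linA]
  proof (intro allI impI)
    fix x assume "A x = 0"
    then have "h x x = 0"
      by (simp add: hA)
    then show "x = 0"
      using pos[of x] by fastforce
  qed
  then obtain u where "A u = (\<Sum>e\<in>Basis. l e *\<^sub>R e)"
    using linear_injective_imp_surjective[OF linA] by (metis surjD)
  then have hu: "h u v = l v" for v
    using linear_sum[OF l, of "\<lambda>e. (v \<bullet> e) *\<^sub>R e" Basis]
    by (simp add: hA euclidean_representation inner_sum_right linear_cmul[OF l] inner_commute[of _ v] mult.commute)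
  have "u' = u" if "\<forall>v. h u' v = l v" for u'
  proof -
    have "A u' = A u"
      using that hu by (intro vector_eq_rdot[THEN iffD1]) (simp flip: hA)
    then show ?thesis
      using \<open>inj A\<close> by (simp add: inj_eq)
  qed
  with hu show ?thesis
    by blast
qed

lemma gradient_eq:
  assumes "is_inner_product h" "(f has_derivative f') (at w)"
  shows "h (gradient h f w) \<xi> = f' \<xi>"
proof -
  have "frechet_derivative f (at w) = f'" "linear f'"
    using assms(2) frechet_derivative_at has_derivative_linear by auto
  then show ?thesis
    using theI'[OF inner_product_represents[OF assms(1), of f']] by (simp add: gradient_def)
qed

text \<open>Otherwise \<open>f\<close> would vanish on a neighbourhood of \<open>w\<close>, and its
  derivative there would be zero.\<close>

lemma closure_nonzero_if_has_derivative:
  fixes f :: "'b::real_normed_vector \<Rightarrow> real"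
  assumes f: "(f has_derivative f') (at w)" and "f' \<eta> \<noteq> 0"
  shows "w \<in> closure {x. f x \<noteq> 0}"
proof (rule ccontr)
  define U where "U = - closure {x. f x \<noteq> 0}"
  assume "w \<notin> closure {x. f x \<noteq> 0}"
  then have U: "open U" "w \<in> U"
    by (simp_all add: U_def open_Compl)
  have f0: "0 = f x" if "x \<in> U" for x
    using that closure_subset[THEN subsetD, of x "{x. f x \<noteq> 0}"] unfolding U_def by fastforce
  have "(f has_derivative (\<lambda>_. 0)) (at w)"
    by (rule has_derivative_transform_within_open[OF has_derivative_const U f0])
  then have "f' = (\<lambda>_. 0)"
    using f has_derivative_unique by blast
  with assms(2) show False
    by simp
qed

lemma dense_open_finite_INT:
  assumes "finite I" "\<And>i. i \<in> I \<Longrightarrow> open (A i)" "\<And>i. i \<in> I \<Longrightarrow> closure (A i) = UNIV"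
  shows "closure (\<Inter>i\<in>I. A i) = UNIV"
  using assms
proof (induction I rule: finite_induct)
  case (insert i I)
  then have "closure (A i \<inter> (\<Inter>i\<in>I. A i)) = closure (A i)"
    by (intro closure_open_Int_superset) auto
  with insert show ?case
    by simp
qed simp

section \<open>The symplectic form of the Heisenberg group\<close>

lemma bounded_linear_J: "bounded_linear (J :: (real ^ 'n::finite) \<times> _ \<Rightarrow> _)"
  using linear_J linear_conv_bounded_linear by blast

lemmas J_linear = linear_0[OF linear_J] linear_add[OF linear_J] linear_diff[OF linear_J]
  linear_neg[OF linear_J] linear_cmul[OF linear_J]

lemma inner_J_swap: "u \<bullet> J v = - (v \<bullet> J u)" for u v :: "(real ^ 'n::finite) \<times> _"
  by (simp add: J_def inner_prod_def inner_commute)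

text \<open>
  The frame component of the velocity along the centre.  With \<open>w = ((v, z), (U, t))\<close>, the
  functions \<open>v\<close>, \<open>z\<close>, \<open>U\<close>, \<open>zeta\<close> are coordinates on the tangent bundle; \<open>beta\<close> is
  the left-invariant form dual to the centre.
\<close>

definition zeta :: "'n::finite heis \<times> 'n heis \<Rightarrow> real" where
  "zeta w = snd (snd w) + (fst (fst w) \<bullet> J (fst (snd w))) / 2"

definition dzeta :: "'n::finite heis \<times> 'n heis \<Rightarrow> 'n heis \<times> 'n heis \<Rightarrow> real" where
  "dzeta w \<eta> = snd (snd \<eta>) + (fst (fst \<eta>) \<bullet> J (fst (snd w)) + fst (fst w) \<bullet> J (fst (snd \<eta>))) / 2"

definition beta :: "'n::finite heis \<times> 'n heis \<Rightarrow> 'n heis \<times> 'n heis \<Rightarrow> real" where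
  "beta w \<eta> = snd (fst \<eta>) + (fst (fst w) \<bullet> J (fst (fst \<eta>))) / 2"

lemma has_derivative_zeta: "(zeta has_derivative dzeta w) (at w)"
  unfolding zeta_def[abs_def] dzeta_def[abs_def]
  by (auto intro!: derivative_eq_intros bounded_linear.has_derivative[OF bounded_linear_J] simp: fun_eq_iff)

lemma frechet_derivative_heis_mult:
  "frechet_derivative (heis_mult p) (at q) = (\<lambda>u. (fst u, snd u - (fst p \<bullet> J (fst u)) / 2))"
  using has_derivative_heis_mult by (rule frechet_derivative_at[symmetric])

lemma heis_metric_eq:
  "heis_metric p u v =
     fst u \<bullet> fst v + (snd u + (fst p \<bullet> J (fst u)) / 2) * (snd v + (fst p \<bullet> J (fst v)) / 2)"
  by (simp add: heis_metric_def Let_def frechet_derivative_heis_mult heis_inv_def)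

lemma Theta_heis_metric:
  "Theta heis_metric w \<eta> = fst (snd w) \<bullet> fst (fst \<eta>) + zeta w * beta w \<eta>"
  by (simp add: Theta_def heis_metric_eq zeta_def beta_def)

lemma has_derivative_Theta:
  "((\<lambda>w. Theta heis_metric w \<eta>) has_derivative
     (\<lambda>\<xi>. fst (snd \<xi>) \<bullet> fst (fst \<eta>) + dzeta w \<xi> * beta w \<eta>
        + zeta w * (fst (fst \<xi>) \<bullet> J (fst (fst \<eta>))) / 2)) (at w)"
  unfolding Theta_heis_metric beta_def
  by (auto intro!: derivative_eq_intros has_derivative_zeta simp: fun_eq_iff)

text \<open>The last term is \<open>- zeta w\<close> times the exterior derivative of
  \<open>beta\<close>, which does not vanish because the group is not commutative; its two halves
  combine by skew symmetry of \<open>J\<close>.\<close>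

lemma Omega_heis_metric:
  "Omega heis_metric w \<xi> \<eta> =
     fst (snd \<eta>) \<bullet> fst (fst \<xi>) - fst (snd \<xi>) \<bullet> fst (fst \<eta>)
     + dzeta w \<eta> * beta w \<xi> - dzeta w \<xi> * beta w \<eta>
     + zeta w * (fst (fst \<eta>) \<bullet> J (fst (fst \<xi>)))"
  using inner_J_swap[of "fst (fst \<xi>)" "fst (fst \<eta>)"]
  unfolding Omega_def exterior_derivative_def
    frechet_derivative_at[OF has_derivative_Theta, symmetric]
  by (simp add: algebra_simps)

text \<open>Each test vector is nonzero on only one of the coframe components \<open>dv\<close>,
  \<open>beta\<close>, \<open>dU\<close>, \<open>dzeta\<close>, which isolates one component of
  \<open>\<xi> - \<xi>'\<close>. For the vector components the difference itself is inserted, giving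
  a squared norm.\<close>

lemma Omega_heis_metric_nondegenerate:
  assumes "\<And>\<eta>. Omega heis_metric w \<xi> \<eta> = Omega heis_metric w \<xi>' \<eta>"
  shows "\<xi> = \<xi>'"
proof -
  note O = assms[unfolded Omega_heis_metric]
  define A where "A = fst (fst \<xi>) - fst (fst \<xi>')"
  have "A \<bullet> fst (fst \<xi>) = A \<bullet> fst (fst \<xi>')"
    using O[of "((0, 0), (A, - (fst (fst w) \<bullet> J A) / 2))"] by (simp add: dzeta_def beta_def J_linear)
  then have "A \<bullet> (fst (fst \<xi>) - fst (fst \<xi>')) = 0"
    by (simp only: inner_diff_right)
  then have "A = 0"
    by (simp flip: A_def)
  then have 1: "fst (fst \<xi>) = fst (fst \<xi>')"
    by (simp add: A_def)
  have 2: "snd (fst \<xi>) = snd (fst \<xi>')"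
    using O[of "((0, 0), (0, 1))"] 1 by (simp add: dzeta_def beta_def J_linear)
  define V where "V = fst (snd \<xi>) - fst (snd \<xi>')"
  have "fst (snd \<xi>) \<bullet> V = fst (snd \<xi>') \<bullet> V"
    using O[of "((V, - (fst (fst w) \<bullet> J V) / 2), (0, - (V \<bullet> J (fst (snd w))) / 2))"] 1
    by (simp add: dzeta_def beta_def J_linear)
  then have "(fst (snd \<xi>) - fst (snd \<xi>')) \<bullet> V = 0"
    by (simp only: inner_diff_left)
  then have "V = 0"
    by (simp flip: V_def)
  then have 3: "fst (snd \<xi>) = fst (snd \<xi>')"
    by (simp add: V_def)
  have "snd (snd \<xi>) = snd (snd \<xi>')"
    using O[of "((0, 1), (0, 0))"] 1 3 by (simp add: dzeta_def beta_def J_linear)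
  with 1 2 3 show ?thesis
    by (simp add: prod_eq_iff)
qed

text \<open>A covector without \<open>beta\<close> component: all functions considered are
  independent of the central coordinate once \<open>v\<close>, \<open>U\<close> and
  \<open>zeta\<close> are coordinates.\<close>

definition coframe_deriv ::
    "'n::finite heis \<times> 'n heis \<Rightarrow> (real ^ 'n) \<times> (real ^ 'n) \<Rightarrow> (real ^ 'n) \<times> (real ^ 'n) \<Rightarrow> real \<Rightarrow>
     'n heis \<times> 'n heis \<Rightarrow> real" where
  "coframe_deriv w P Q c \<eta> = P \<bullet> fst (fst \<eta>) + Q \<bullet> fst (snd \<eta>) + c * dzeta w \<eta>"

text \<open>In the coframe the field has \<open>dv = Q\<close>, \<open>beta = c\<close>,
  \<open>dU = R\<close> and \<open>dzeta = 0\<close>; the correction terms translate this back to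
  standard coordinates. The zero reflects the missing \<open>beta\<close> component of the
  differential.\<close>

lemma hamiltonian_field_heis_metric:
  assumes "(f has_derivative coframe_deriv w P Q c) (at w)"
  defines "R \<equiv> zeta w *\<^sub>R J Q - P"
  shows "hamiltonian_field heis_metric f w =
    ((Q, c - (fst (fst w) \<bullet> J Q) / 2), (R, - (Q \<bullet> J (fst (snd w)) + fst (fst w) \<bullet> J R) / 2))"
    (is "_ = ?X")
proof -
  have d: "frechet_derivative f (at w) = coframe_deriv w P Q c"
    using assms(1) by (rule frechet_derivative_at[symmetric])
  have X: "dzeta w ?X = 0" "beta w ?X = c"
    by (simp_all add: dzeta_def beta_def add_divide_distrib diff_divide_distrib)
  have Omega_X: "Omega heis_metric w ?X \<eta> = coframe_deriv w P Q c \<eta>" for \<eta>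
    unfolding Omega_heis_metric X
    by (simp add: coframe_deriv_def R_def inner_diff_left inner_commute algebra_simps)
  show ?thesis
    unfolding hamiltonian_field_def d
  proof (rule the_equality)
    fix \<xi>
    assume "\<forall>\<eta>. coframe_deriv w P Q c \<eta> = Omega heis_metric w \<xi> \<eta>"
    then show "\<xi> = ?X"
      by (intro Omega_heis_metric_nondegenerate[of w]) (simp only: Omega_X)
  qed (intro allI, simp only: Omega_X)
qed

text \<open>The canonical bracket in \<open>v\<close> and \<open>U\<close> plus a magnetic term of
  strength \<open>zeta w\<close>. The coefficients \<open>c\<close> and \<open>c'\<close> drop out
  because \<open>dzeta\<close> vanishes on both Hamiltonian fields.\<close>

lemma poisson_heis_metric:
  assumes f: "(f has_derivative coframe_deriv w P Q c) (at w)"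
    and g: "(g has_derivative coframe_deriv w P' Q' c') (at w)"
  shows "poisson heis_metric f g w = P \<bullet> Q' - Q \<bullet> P' + zeta w * (Q \<bullet> J Q')"
  unfolding poisson_def hamiltonian_field_heis_metric[OF f] hamiltonian_field_heis_metric[OF g] Omega_heis_metric
  using inner_J_swap[of Q Q']
  by (simp add: dzeta_def beta_def inner_diff_left inner_diff_right inner_commute algebra_simps
      add_divide_distrib diff_divide_distrib)

section \<open>The first integrals\<close>

definition xpos :: "'n::finite \<Rightarrow> 'n heis \<times> 'n heis \<Rightarrow> real" where
  "xpos i w = fst (fst (fst w)) $ i"

definition xvel :: "'n::finite \<Rightarrow> 'n heis \<times> 'n heis \<Rightarrow> real" where
  "xvel i w = fst (fst (snd w)) $ i"

definition yvel :: "'n::finite \<Rightarrow> 'n heis \<times> 'n heis \<Rightarrow> real" where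
  "yvel i w = snd (fst (snd w)) $ i"

text \<open>The momentum of the Killing field generated by left translations in the direction of \<open>y\<^sub>i\<close>.\<close>

definition ymom :: "'n::finite \<Rightarrow> 'n heis \<times> 'n heis \<Rightarrow> real" where
  "ymom i w = yvel i w - zeta w * xpos i w"

text \<open>The index type has \<open>2n + 1\<close> elements, the dimension of the group.\<close>

fun integral_of :: "('n::finite + 'n) option \<Rightarrow> 'n heis \<times> 'n heis \<Rightarrow> real" where
  "integral_of None = zeta"
| "integral_of (Some (Inl i)) = (\<lambda>w. (xvel i w)\<^sup>2 + (yvel i w)\<^sup>2)"
| "integral_of (Some (Inr i)) = flat_osc zeta (ymom i) 0 0"

section \<open>Differentials and Poisson brackets of the integrals\<close>

lemma has_derivative_xvel: "(xvel i has_derivative xvel i) (at w)"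
  unfolding xvel_def[abs_def]
  by (auto intro!: derivative_eq_intros bounded_linear.has_derivative[OF bounded_linear_vec_nth])

lemma has_derivative_yvel: "(yvel i has_derivative yvel i) (at w)"
  unfolding yvel_def[abs_def]
  by (auto intro!: derivative_eq_intros bounded_linear.has_derivative[OF bounded_linear_vec_nth])

lemma has_derivative_xpos: "(xpos i has_derivative xpos i) (at w)"
  unfolding xpos_def[abs_def]
  by (auto intro!: derivative_eq_intros bounded_linear.has_derivative[OF bounded_linear_vec_nth])

lemma has_derivative_ymom:
  "(ymom i has_derivative (\<lambda>\<eta>. yvel i \<eta> - (zeta w * xpos i \<eta> + dzeta w \<eta> * xpos i w))) (at w)"
  unfolding ymom_def[abs_def]
  by (intro has_derivative_diff has_derivative_mult has_derivative_xpos has_derivative_yvel has_derivative_zeta)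

text \<open>Here \<open>q\<close> is the partial derivative in the momentum. Since the differential
  of \<open>ymom i\<close> also contains \<open>dzeta\<close> with coefficient
  \<open>- xpos i w\<close>, part of \<open>q\<close> moves into the last coefficient.\<close>

lemma has_derivative_flat_osc_ymom:
  fixes w :: "'n::finite heis \<times> 'n heis"
  defines "q \<equiv> \<lambda>m c i. flat_osc_deriv zeta (ymom i) m c 0 1 w"
  shows "(flat_osc zeta (ymom i) m c has_derivative
     coframe_deriv w (axis i (- zeta w * q m c i), 0) (0, axis i (q m c i))
       (flat_osc_deriv zeta (ymom i) m c 1 0 w - xpos i w * q m c i)) (at w)"
  by (rule has_derivative_eq_rhs[OF has_derivative_flat_osc[OF has_derivative_zeta has_derivative_ymom]])
    (simp add: fun_eq_iff q_def coframe_deriv_def flat_osc_deriv_def inner_prod_def inner_axis'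
      xpos_def yvel_def algebra_simps)

fun coef_P :: "'n::finite heis \<times> 'n heis \<Rightarrow> ('n + 'n) option \<Rightarrow> (real ^ 'n) \<times> (real ^ 'n)" where
  "coef_P w (Some (Inr i)) = (axis i (- zeta w * flat_osc_deriv zeta (ymom i) 0 0 0 1 w), 0)"
| "coef_P w _ = 0"

fun coef_Q :: "'n::finite heis \<times> 'n heis \<Rightarrow> ('n + 'n) option \<Rightarrow> (real ^ 'n) \<times> (real ^ 'n)" where
  "coef_Q w None = 0"
| "coef_Q w (Some (Inl i)) = (axis i (2 * xvel i w), axis i (2 * yvel i w))"
| "coef_Q w (Some (Inr i)) = (0, axis i (flat_osc_deriv zeta (ymom i) 0 0 0 1 w))"

fun coef_zeta :: "'n::finite heis \<times> 'n heis \<Rightarrow> ('n + 'n) option \<Rightarrow> real" where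
  "coef_zeta w None = 1"
| "coef_zeta w (Some (Inl i)) = 0"
| "coef_zeta w (Some (Inr i)) =
     flat_osc_deriv zeta (ymom i) 0 0 1 0 w - xpos i w * flat_osc_deriv zeta (ymom i) 0 0 0 1 w"

lemma has_derivative_integral_of:
  "(integral_of k has_derivative coframe_deriv w (coef_P w k) (coef_Q w k) (coef_zeta w k)) (at w)"
proof (cases k rule: integral_of.cases)
  case 1
  then show ?thesis
    using has_derivative_zeta by (simp add: coframe_deriv_def[abs_def])
next
  case (2 i)
  have "((\<lambda>w. (xvel i w)\<^sup>2 + (yvel i w)\<^sup>2) has_derivative
      (\<lambda>\<eta>. 2 * xvel i w * xvel i \<eta> + 2 * yvel i w * yvel i \<eta>)) (at w)"
    by (auto intro!: derivative_eq_intros has_derivative_xvel has_derivative_yvel)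
  with 2 show ?thesis
    by (simp add: coframe_deriv_def[abs_def] inner_prod_def inner_axis' xvel_def yvel_def)
next
  case (3 i)
  then show ?thesis
    using has_derivative_flat_osc_ymom[of i 0 0 w] by simp
qed

lemma energy_heis_metric: "energy heis_metric w = (fst (snd w) \<bullet> fst (snd w) + (zeta w)\<^sup>2) / 2"
  by (simp add: energy_def heis_metric_eq zeta_def power2_eq_square)

lemma has_derivative_energy:
  "(energy heis_metric has_derivative coframe_deriv w 0 (fst (snd w)) (zeta w)) (at w)"
  unfolding energy_heis_metric[abs_def]
  by (auto intro!: derivative_eq_intros has_derivative_zeta simp: coframe_deriv_def inner_commute)

text \<open>Most terms vanish by the positions of the zero entries or by skew symmetry of
  \<open>J\<close>. Only for \<open>Inl i\<close> against \<open>Inr i\<close> do the canonical and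
  the magnetic term cancel each other.\<close>

lemma poisson_integral_of: "poisson heis_metric (integral_of k) (integral_of l) w = 0"
  unfolding poisson_heis_metric[OF has_derivative_integral_of has_derivative_integral_of]
  by (cases k rule: integral_of.cases; cases l rule: integral_of.cases)
    (simp_all add: inner_prod_def J_def inner_axis_axis)

text \<open>For \<open>Inl i\<close> the magnetic term vanishes by skew symmetry of \<open>J\<close>
  in the \<open>i\<close>-th plane; for \<open>Inr i\<close> it cancels the canonical term.\<close>

lemma poisson_integral_of_energy: "poisson heis_metric (integral_of k) (energy heis_metric) w = 0"
  unfolding poisson_heis_metric[OF has_derivative_integral_of has_derivative_energy]
  by (cases k rule: integral_of.cases)
    (simp_all add: inner_prod_def J_def inner_axis' xvel_def yvel_def)

section \<open>Smoothness of the integrals\<close>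

lemma real_polynomial_function_zeta: "real_polynomial_function (zeta :: 'n::finite heis \<times> 'n heis \<Rightarrow> real)"
proof -
  have "bounded_linear (\<lambda>w :: 'n heis \<times> 'n heis. fst (fst w) \<bullet> e)"
    "bounded_linear (\<lambda>w :: 'n heis \<times> 'n heis. J (fst (snd w)) \<bullet> e)"
    "bounded_linear (\<lambda>w :: 'n heis \<times> 'n heis. snd (snd w))" for e
    by (intro bounded_linear_compose[OF bounded_linear_inner_left] bounded_linear_compose[OF bounded_linear_J]
        bounded_linear_compose[OF bounded_linear_fst] bounded_linear_compose[OF bounded_linear_snd]
        bounded_linear_fst bounded_linear_snd)+
  note lin = this[THEN real_polynomial_function.intros(1)]
  \<comment> \<open>The inner product is expanded in a basis to expose products of linear
    functions.\<close>
  have "real_polynomial_function (\<lambda>w :: 'n heis \<times> 'n heis. snd (snd w) +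
      (\<Sum>e\<in>Basis. (fst (fst w) \<bullet> e) * (J (fst (snd w)) \<bullet> e)) / 2)"
    by (intro real_polynomial_function.intros(3,4) real_polynomial_function_divide
        real_polynomial_function_sum lin finite_Basis)
  then show ?thesis
    by (simp add: zeta_def[abs_def] flip: euclidean_inner)
qed

lemmas real_polynomial_function_coordinate =
  has_derivative_bounded_linear[OF has_derivative_xpos, THEN real_polynomial_function.intros(1)]
  has_derivative_bounded_linear[OF has_derivative_xvel, THEN real_polynomial_function.intros(1)]
  has_derivative_bounded_linear[OF has_derivative_yvel, THEN real_polynomial_function.intros(1)]

lemma real_polynomial_function_ymom: "real_polynomial_function (ymom i)"
  unfolding ymom_def[abs_def]
  by (intro real_polynomial_function_diff real_polynomial_function.intros(4) real_polynomial_function_zeta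
      real_polynomial_function_coordinate)

text \<open>Polynomials lie in the algebra for any \<open>z\<close> and \<open>b\<close>;
  \<open>p\<close> itself is taken for both.\<close>

lemma smooth_real_polynomial_function: "real_polynomial_function p \<Longrightarrow> smooth p"
  by (rule smooth_flat_osc_algebra[OF _ _ flat_osc_algebra.poly])

lemma smooth_integral_of: "smooth (integral_of k)"
proof (cases k rule: integral_of.cases)
  case 1
  then show ?thesis
    by (simp add: smooth_real_polynomial_function real_polynomial_function_zeta)
next
  case (2 i)
  have "real_polynomial_function (\<lambda>w. (xvel i w)\<^sup>2 + (yvel i w)\<^sup>2)"
    by (intro real_polynomial_function.intros(3) real_polynomial_function_power
        real_polynomial_function_coordinate)
  with 2 show ?thesis
    by (simp add: smooth_real_polynomial_function)
next
  case (3 i)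
  then show ?thesis
    by (simp add: smooth_flat_osc_algebra[OF real_polynomial_function_zeta real_polynomial_function_ymom
          flat_osc_algebra.osc])
qed

section \<open>Invariance under the lattice\<close>

lemma tangent_map_heis_mult:
  "tangent_map (heis_mult k) w =
     (heis_mult k (fst w), (fst (snd w), snd (snd w) - (fst k \<bullet> J (fst (snd w))) / 2))"
  by (simp add: tangent_map_def frechet_derivative_heis_mult)

text \<open>\<open>zeta\<close>, \<open>xvel\<close> and \<open>yvel\<close> are coordinates in the
  left-invariant frame, whereas \<open>ymom\<close> also contains the position \<open>xpos\<close>,
  which left translation shifts.\<close>

lemma tangent_map_heis_mult_simps:
  "zeta (tangent_map (heis_mult k) w) = zeta w"
  "xvel i (tangent_map (heis_mult k) w) = xvel i w"
  "yvel i (tangent_map (heis_mult k) w) = yvel i w"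
  "ymom i (tangent_map (heis_mult k) w) = ymom i w - zeta w * fst (fst k) $ i"
proof -
  show z: "zeta (tangent_map (heis_mult k) w) = zeta w"
    by (simp add: tangent_map_heis_mult zeta_def heis_mult_def inner_add_left add_divide_distrib)
  show "xvel i (tangent_map (heis_mult k) w) = xvel i w"
    "yvel i (tangent_map (heis_mult k) w) = yvel i w"
    by (simp_all add: tangent_map_heis_mult xvel_def yvel_def)
  then show "ymom i (tangent_map (heis_mult k) w) = ymom i w - zeta w * fst (fst k) $ i"
    unfolding ymom_def z by (simp add: tangent_map_heis_mult xpos_def heis_mult_def algebra_simps)
qed

text \<open>The phase moves by whole periods; where \<open>z\<close> vanishes both sides are
  0.\<close>

lemma flat_osc_periodic:
  assumes "z x' = z x" "b x' = b x - z x * of_int n"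
  shows "flat_osc z b m c x' = flat_osc z b m c x"
proof (cases "z x = 0")
  case False
  then have "2 * pi * b x' / z x' + c = (2 * pi * b x / z x + c) - of_int n * (2 * pi)"
    by (simp add: assms field_simps)
  then have "sin (2 * pi * b x' / z x' + c) = sin ((2 * pi * b x / z x + c) - of_int n * (2 * pi))"
    by (simp only:)
  also have "\<dots> = sin (2 * pi * b x / z x + c)"
    unfolding sin_diff[of _ "of_int n * (2 * pi)"] by (simp add: mult.commute[of _ "2 * pi"] sin_int_2pin cos_int_2pin)
  finally show ?thesis
    by (simp add: flat_osc_def assms(1))
qed (simp add: flat_osc_def assms(1))

lemma flat_osc_ymom_deck_invariant:
  assumes "\<gamma> \<in> heis_deck_group r"
  shows "flat_osc zeta (ymom i) m c (tangent_map \<gamma> w) = flat_osc zeta (ymom i) m c w"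
proof -
  obtain k where k: "k \<in> heis_lattice r" "\<gamma> = heis_mult k"
    using assms by (auto simp: heis_deck_group_def)
  then obtain n :: int where "fst (fst k) $ i = real (r $ i) * of_int n"
    by (fastforce simp: heis_lattice_def)
  then have "fst (fst k) $ i = of_int (int (r $ i) * n)"
    by simp
  then show ?thesis
    unfolding k(2) by (intro flat_osc_periodic) (simp_all only: tangent_map_heis_mult_simps)
qed

lemma integral_of_deck_invariant:
  assumes "\<gamma> \<in> heis_deck_group r"
  shows "integral_of k (tangent_map \<gamma> w) = integral_of k w"
proof -
  obtain p where "\<gamma> = heis_mult p"
    using assms by (auto simp: heis_deck_group_def)
  then show ?thesis
    using flat_osc_ymom_deck_invariant[OF assms]
    by (cases k rule: integral_of.cases) (simp_all add: tangent_map_heis_mult_simps)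
qed

lemma energy_deck_invariant:
  assumes "\<gamma> \<in> heis_deck_group r"
  shows "energy heis_metric (tangent_map \<gamma> w) = energy heis_metric w"
proof -
  obtain p where "\<gamma> = heis_mult p"
    using assms by (auto simp: heis_deck_group_def)
  then show ?thesis
    by (simp add: energy_def tangent_map_def heis_metric_left_invariant)
qed

text \<open>The lift is an arbitrary choice, which an invariant \<open>f\<close> cannot see. This
  lets functions and sets on the quotient be defined by evaluation at the lift.\<close>

lemma tangent_lift_invariant:
  assumes "tangent_map e = id" "e \<in> \<Gamma>"
    and inv: "\<And>\<gamma> w. \<gamma> \<in> \<Gamma> \<Longrightarrow> f (tangent_map \<gamma> w) = f w"
  shows "f (tangent_lift \<Gamma> (tangent_proj \<Gamma> w)) = f w"
proof -
  define w' where "w' = tangent_lift \<Gamma> (tangent_proj \<Gamma> w)"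
  have "tangent_proj \<Gamma> w' = tangent_proj \<Gamma> w"
    unfolding w'_def tangent_lift_def by (rule someI) (rule refl)
  \<comment> \<open>The identity puts \<open>w'\<close> into its own orbit, which is also the orbit
    of \<open>w\<close>.\<close>
  moreover have "id \<in> tangent_map ` \<Gamma>"
    using imageI[OF assms(2), of tangent_map] by (simp only: assms(1))
  then have "w' \<in> tangent_proj \<Gamma> w'"
    unfolding tangent_proj_def orbit_def by (rule image_eqI[rotated]) simp
  ultimately obtain \<gamma> where "\<gamma> \<in> \<Gamma>" "w' = tangent_map \<gamma> w"
    by (auto simp: tangent_proj_def orbit_def)
  then show ?thesis
    using inv[of \<gamma> w] by (simp add: w'_def)
qed

lemma heis_tangent_lift_invariant:
  assumes "\<And>\<gamma> w. \<gamma> \<in> heis_deck_group r \<Longrightarrow> f (tangent_map \<gamma> w) = f w"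
  shows "f (tangent_lift (heis_deck_group r) (tangent_proj (heis_deck_group r) w)) = f w"
proof (rule tangent_lift_invariant[OF _ _ assms])
  show "tangent_map (heis_mult 0) = id"
    by (simp add: fun_eq_iff tangent_map_heis_mult)
  show "heis_mult 0 \<in> heis_deck_group r"
    by (simp add: heis_deck_group_def zero_in_heis_lattice)
qed

section \<open>The regular set\<close>

text \<open>The second function is, up to the factor \<open>2 * pi\<close>, the derivative of the
  oscillating integral in \<open>ymom i\<close>. Its being nonzero also forces
  \<open>zeta w \<noteq> 0\<close>.\<close>

definition regular_set :: "('n::finite heis \<times> 'n heis) set" where
  "regular_set = (\<Inter>i. {w. xvel i w \<noteq> 0} \<inter> {w. flat_osc zeta (ymom i) 1 (pi / 2) w \<noteq> 0})"

lemma dense_xvel_nonzero: "closure {w. xvel i w \<noteq> 0} = UNIV"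
proof -
  have "w \<in> closure {w. xvel i w \<noteq> 0}" for w
    by (rule closure_nonzero_if_has_derivative[OF has_derivative_xvel, of _ "((0, 0), ((axis i 1, 0), 0))"])
      (simp add: xvel_def)
  then show ?thesis
    by auto
qed

lemma dense_zeta_nonzero: "closure {w :: 'n::finite heis \<times> 'n heis. zeta w \<noteq> 0} = UNIV"
proof -
  have "w \<in> closure {w. zeta w \<noteq> 0}" for w :: "'n heis \<times> 'n heis"
    by (rule closure_nonzero_if_has_derivative[OF has_derivative_zeta, of _ "((0, 0), (0, 1))"])
      (simp add: dzeta_def J_linear)
  then show ?thesis
    by auto
qed

text \<open>Where \<open>zeta\<close> does not vanish, the zeros of \<open>flat_osc\<close> are simple, since those of the sine are.\<close>

lemma dense_flat_osc_ymom_nonzero: "closure {w. flat_osc zeta (ymom i) m c w \<noteq> 0} = UNIV"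
proof -
  let ?S = "{w. flat_osc zeta (ymom i) m c w \<noteq> 0}"
  have "w \<in> closure ?S" if "zeta w \<noteq> 0" for w
  proof (cases "w \<in> ?S")
    case False
    let ?t = "2 * pi * ymom i w / zeta w + c"
    have "sin ?t = 0"
      using False that by (simp add: flat_osc_def)
    then have "cos ?t \<noteq> 0"
      using sin_zero_norm_cos_one by force
    moreover have "sin (2 * pi * ymom i w / zeta w + (c + pi / 2)) = cos ?t"
      by (simp add: sin_add cos_add)
    ultimately have "flat_osc zeta (ymom i) (m + 1) (c + pi / 2) w \<noteq> 0"
      using that by (simp add: flat_osc_def)
    then have "flat_osc_deriv zeta (ymom i) m c 0 1 w \<noteq> 0"
      by (simp add: flat_osc_deriv_def)
    \<comment> \<open>The test vector moves \<open>yvel i\<close> and is corrected so that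
      \<open>dzeta\<close> vanishes on it.\<close>
    then show ?thesis
      by (intro closure_nonzero_if_has_derivative[OF has_derivative_flat_osc_ymom,
            of _ _ _ _ "((0, 0), ((0, axis i 1), - (fst (fst w) \<bullet> J (0, axis i 1)) / 2))"])
        (simp add: coframe_deriv_def dzeta_def inner_axis_axis)
  qed (rule closure_subset[THEN subsetD])
  then have "closure {w. zeta w \<noteq> 0} \<subseteq> closure ?S"
    by (intro closure_minimal) auto
  then show ?thesis
    by (auto simp: dense_zeta_nonzero)
qed

lemma open_dense_regular_set:
  "open (regular_set :: ('n::finite heis \<times> 'n heis) set)" "closure (regular_set :: ('n heis \<times> 'n heis) set) = UNIV"
proof -
  have cont: "continuous_on UNIV f" if "\<And>w. (f has_derivative f' w) (at w)"
    for f :: "'n heis \<times> 'n heis \<Rightarrow> real" and f'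
    using that by (intro continuous_at_imp_continuous_on ballI has_derivative_continuous)
  have op: "open {w. xvel i w \<noteq> 0}" "open {w. flat_osc zeta (ymom i) m c w \<noteq> 0}" for i :: 'n and m c
    by (intro open_Collect_neq continuous_on_const cont[OF has_derivative_xvel] cont[OF has_derivative_flat_osc_ymom])+
  show "open (regular_set :: ('n heis \<times> 'n heis) set)"
    unfolding regular_set_def by (intro open_INT open_Int op ballI finite)
  have "closure ({w. xvel i w \<noteq> 0} \<inter> {w. flat_osc zeta (ymom i) m c w \<noteq> 0}) = UNIV" for i :: 'n and m c
    by (subst closure_open_Int_superset) (auto simp: op dense_xvel_nonzero dense_flat_osc_ymom_nonzero)
  then show "closure (regular_set :: ('n heis \<times> 'n heis) set) = UNIV"
    unfolding regular_set_def by (intro dense_open_finite_INT open_Int op finite)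
qed

lemma regular_set_deck_invariant:
  assumes "\<gamma> \<in> heis_deck_group r"
  shows "tangent_map \<gamma> w \<in> regular_set \<longleftrightarrow> w \<in> regular_set"
proof -
  obtain p where "\<gamma> = heis_mult p"
    using assms by (auto simp: heis_deck_group_def)
  then have "xvel i (tangent_map \<gamma> w) = xvel i w" for i
    by (simp add: tangent_map_heis_mult_simps)
  then show ?thesis
    by (simp add: regular_set_def flat_osc_ymom_deck_invariant[OF assms])
qed

text \<open>Pairing with \<open>h\<close> turns the relation into one between differentials,
  whatever \<open>h\<close> is. Three kinds of test vectors then eliminate the coefficients in
  triangular order.\<close>

lemma gradients_integral_of_independent:
  assumes w: "w \<in> regular_set" and h: "is_inner_product h"
    and sum0: "(\<Sum>k\<in>UNIV. C k *\<^sub>R gradient h (integral_of k) w) = 0"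
  shows "C k = 0"
proof -
  have "linear (h \<xi>)" "(\<lambda>u. h u \<xi>) = h \<xi>" for \<xi>
    using h by (auto simp: is_inner_product_def simp del: split_paired_All)
  then have lin: "linear (\<lambda>u. h u \<xi>)" for \<xi>
    by simp
  have *: "(\<Sum>k\<in>UNIV. C k * coframe_deriv w (coef_P w k) (coef_Q w k) (coef_zeta w k) \<xi>) = 0" for \<xi>
    using arg_cong[OF sum0, of "\<lambda>u. h u \<xi>"]
    by (simp add: linear_sum[OF lin] linear_cmul[OF lin] linear_0[OF lin]
        gradient_eq[OF h has_derivative_integral_of])
  have reg: "xvel i w \<noteq> 0" "flat_osc zeta (ymom i) 1 (pi / 2) w \<noteq> 0" for i
    using w by (auto simp: regular_set_def)
  then have "flat_osc_deriv zeta (ymom i) 0 0 0 1 w \<noteq> 0" "zeta w \<noteq> 0" for i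
    by (auto simp: flat_osc_deriv_def flat_osc_def)
  moreover have "C (Some (Inr i)) * (- zeta w * flat_osc_deriv zeta (ymom i) 0 0 0 1 w) = 0" for i
  proof -
    \<comment> \<open>Moves \<open>x\<close> in direction \<open>i\<close> with
      \<open>dzeta = 0\<close>, so only the component \<open>P\<close> is seen; it is nonzero only
      for \<open>Inr i\<close>.\<close>
    let ?\<xi> = "(((axis i 1, 0), 0), (0, - ((axis i 1, 0) \<bullet> J (fst (snd w))) / 2))"
    have "C k * coframe_deriv w (coef_P w k) (coef_Q w k) (coef_zeta w k) ?\<xi> =
      (if k = Some (Inr i) then C k * (- zeta w * flat_osc_deriv zeta (ymom i) 0 0 0 1 w) else 0)" for k
      by (cases k rule: integral_of.cases)
        (auto simp: coframe_deriv_def dzeta_def J_linear inner_axis_axis)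
    with *[of ?\<xi>] show ?thesis
      by simp
  qed
  ultimately have r: "C (Some (Inr i)) = 0" for i
    by simp
  have "C (Some (Inl i)) * (2 * xvel i w) = 0" for i
  proof -
    \<comment> \<open>Moves \<open>xvel i\<close> with \<open>dzeta = 0\<close>: only
      \<open>Inl i\<close> has an entry there.\<close>
    let ?\<xi> = "((0, 0), ((axis i 1, 0), - (fst (fst w) \<bullet> J (axis i 1, 0)) / 2))"
    have "C k * coframe_deriv w (coef_P w k) (coef_Q w k) (coef_zeta w k) ?\<xi> =
      (if k = Some (Inl i) then C k * (2 * xvel i w) else 0)" for k
      by (cases k rule: integral_of.cases)
        (auto simp: coframe_deriv_def dzeta_def inner_axis_axis)
    with *[of ?\<xi>] show ?thesis
      by simp
  qed
  then have l: "C (Some (Inl i)) = 0" for i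
    using reg by simp
  have "C None = 0"
  proof -
    \<comment> \<open>Only \<open>dzeta\<close> is seen here. The oscillating integrals may
      contribute to it too, but their coefficients are already zero by \<open>r\<close>.\<close>
    have "C k * coframe_deriv w (coef_P w k) (coef_Q w k) (coef_zeta w k) ((0, 0), (0, 1)) =
      (if k = None then C k else 0)" for k
      by (cases k rule: integral_of.cases)
        (auto simp: coframe_deriv_def dzeta_def J_linear r l)
    with *[of "((0, 0), (0, 1))"] show ?thesis
      by simp
  qed
  with l r show ?thesis
    by (cases k rule: integral_of.cases) auto
qed

text \<open>Since \<open>S\<close> is saturated, the preimage of \<open>U\<close> is
  \<open>S\<close>, so openness is that of the quotient topology, and density follows because
  preimages of nonempty open sets meet \<open>S\<close>.\<close>

lemma open_dense_tangent_bundle: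
  assumes S: "open S" "closure S = UNIV"
    and lift: "\<And>w. tangent_lift \<Gamma> (tangent_proj \<Gamma> w) \<in> S \<longleftrightarrow> w \<in> S"
  defines "U \<equiv> {W \<in> tangent_bundle \<Gamma>. tangent_lift \<Gamma> W \<in> S}"
  shows "openin (tangent_topology \<Gamma>) U" "tangent_topology \<Gamma> closure_of U = tangent_bundle \<Gamma>"
proof -
  have pre: "tangent_proj \<Gamma> -` U = S"
    by (auto simp: U_def lift tangent_bundle_def)
  then show "openin (tangent_topology \<Gamma>) U"
    using S by (auto simp: openin_tangent_topology U_def)
  have "\<exists>W\<in>U. W \<in> T" if "tangent_proj \<Gamma> w \<in> T" "openin (tangent_topology \<Gamma>) T" for w T
  proof -
    have "open (tangent_proj \<Gamma> -` T)" "w \<in> tangent_proj \<Gamma> -` T"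
      using that by (auto simp: openin_tangent_topology)
    then have "tangent_proj \<Gamma> -` T \<inter> S \<noteq> {}"
      using open_Int_closure_eq_empty[of "tangent_proj \<Gamma> -` T" S] S(2) by auto
    then obtain w' where "w' \<in> S" "tangent_proj \<Gamma> w' \<in> T"
      by auto
    then show ?thesis
      using pre by blast
  qed
  then show "tangent_topology \<Gamma> closure_of U = tangent_bundle \<Gamma>"
    by (auto simp: closure_of_def topspace_tangent_topology tangent_bundle_def)
qed

theorem corollary4p12:
  fixes r :: "nat ^ 'n::{finite,linorder}"
  assumes "\<forall>i. 0 < r $ i"
    and "\<forall>i j. i \<le> j \<longrightarrow> r $ i dvd r $ j"
  shows "geodesic_flow_completely_integrable (heis_deck_group r) heis_metric"
proof -
  let ?\<Gamma> = "heis_deck_group r"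
  let ?m = "DIM('n heis)"
  have "?m = card (UNIV :: ('n + 'n) option set)"
    by (simp add: card_UNIV_option card_UNIV_sum)
  then obtain \<phi> :: "nat \<Rightarrow> ('n + 'n) option" where \<phi>: "bij_betw \<phi> {..<?m} UNIV"
    using ex_bij_betw_nat_finite[OF finite[of "UNIV :: ('n + 'n) option set"]] by (auto simp: atLeast0LessThan)
  define F where "F j W = integral_of (\<phi> j) (tangent_lift ?\<Gamma> W)" for j W
  have F: "F j \<circ> tangent_proj ?\<Gamma> = integral_of (\<phi> j)" for j
    by (simp add: fun_eq_iff F_def heis_tangent_lift_invariant[where f = "integral_of (\<phi> j)"] integral_of_deck_invariant)
  have E: "energy_quotient ?\<Gamma> heis_metric \<circ> tangent_proj ?\<Gamma> = energy heis_metric"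
    by (simp add: fun_eq_iff energy_quotient_def heis_tangent_lift_invariant[where f = "energy heis_metric"]
        energy_deck_invariant)
  define U where "U = {W \<in> tangent_bundle ?\<Gamma>. tangent_lift ?\<Gamma> W \<in> regular_set}"
  have U: "openin (tangent_topology ?\<Gamma>) U" "tangent_topology ?\<Gamma> closure_of U = tangent_bundle ?\<Gamma>"
    unfolding U_def
    by (intro open_dense_tangent_bundle open_dense_regular_set
        heis_tangent_lift_invariant[where f = "\<lambda>w. w \<in> regular_set"] regular_set_deck_invariant; assumption)+
  have "gradients_independent_at ?\<Gamma> ?m F W" if "W \<in> U" for W
    unfolding gradients_independent_at_def independent_family_def F
  proof (intro allI impI)
    fix h :: "'n heis \<times> 'n heis \<Rightarrow> 'n heis \<times> 'n heis \<Rightarrow> real" and c j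
    assume h: "is_inner_product h" and j: "j < ?m"
      and sum0: "(\<Sum>i<?m. c i *\<^sub>R gradient h (integral_of (\<phi> i)) (tangent_lift ?\<Gamma> W)) = 0"
    have inv: "the_inv_into {..<?m} \<phi> (\<phi> i) = i" if "i < ?m" for i
      using \<phi> that by (auto simp: bij_betw_def the_inv_into_f_f)
    \<comment> \<open>The relation is reindexed along \<open>\<phi>\<close>, from numbers below the
      dimension to the index type of the integrals.\<close>
    have "(\<Sum>k\<in>UNIV. c (the_inv_into {..<?m} \<phi> k) *\<^sub>R gradient h (integral_of k) (tangent_lift ?\<Gamma> W)) = 0"
      unfolding sum.reindex_bij_betw[OF \<phi>, symmetric] sum0[symmetric]
      by (rule sum.cong[OF refl]) (simp only: inv lessThan_iff)
    then have "c (the_inv_into {..<?m} \<phi> (\<phi> j)) = 0"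
      using that h by (intro gradients_integral_of_independent) (auto simp: U_def)
    then show "c j = 0"
      by (simp only: inv[OF j])
  qed
  then show ?thesis
    unfolding geodesic_flow_completely_integrable_def smooth_on_tangent_bundle_def first_integral_def
      poisson_quotient_def
    by (intro exI[of _ F] exI[of _ U] conjI)
      (simp_all add: F E U smooth_integral_of poisson_integral_of poisson_integral_of_energy)
qed

end
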